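(* Let $f:X\to Z$ be a homomorphism of quandles, let $\sim$ be the equivalence relation on $X$ given by $x_1\sim x_2$ if and only if $f(x_1)=f(x_2)$, let $X_x=\{x'\in X\mid f(x')=f(x)\}$ denote the equivalence class of $x\in X$, and let $X/_\sim$ be the set of equivalence classes. Then the binary operation $X_{x_1}\circ X_{x_2}=X_{x_1.x_2}$ gives a quandle structure on $X/_\sim$. Further, if $f$ is surjective, then $X/_\sim\cong Z$ as quandles.
   Context: A quandle is a non-empty set $X$ with a binary operation $(x,y)\mapsto x.y$ such that: (R1) for all $x,y\in X$ there is a unique $z\in X$ with $x=z.y$; (R2) $(x.y).z=(x.z).(y.z)$ for all $x,y,z\in X$; (Q1) $x.x=x$ for all $x\in X$. A quandle homomorphism is a map $f$ with $f(x.y)=f(x).f(y)$ for all $x,y$. *)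

theory Defs
  imports Main
begin

locale quandle =
  fixes X :: "'a set" and m :: "'a \<Rightarrow> 'a \<Rightarrow> 'a"
  assumes nonempty: "X \<noteq> {}"
    and closed: "\<lbrakk>x \<in> X; y \<in> X\<rbrakk> \<Longrightarrow> m x y \<in> X"
    and R1: "\<lbrakk>x \<in> X; y \<in> X\<rbrakk> \<Longrightarrow> \<exists>!z. z \<in> X \<and> x = m z y"
    and R2: "\<lbrakk>x \<in> X; y \<in> X; z \<in> X\<rbrakk> \<Longrightarrow> m (m x y) z = m (m x z) (m y z)"
    and Q1: "x \<in> X \<Longrightarrow> m x x = x"

locale quandle_hom = dom: quandle X m + cod: quandle Z n
  for X :: "'a set" and m :: "'a \<Rightarrow> 'a \<Rightarrow> 'a"
    and Z :: "'b set" and n :: "'b \<Rightarrow> 'b \<Rightarrow> 'b" +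
  fixes f :: "'a \<Rightarrow> 'b"
  assumes maps_to: "x \<in> X \<Longrightarrow> f x \<in> Z"
    and hom: "\<lbrakk>x \<in> X; y \<in> X\<rbrakk> \<Longrightarrow> f (m x y) = n (f x) (f y)"

definition quandle_isomorphic ::
  "'a set \<Rightarrow> ('a \<Rightarrow> 'a \<Rightarrow> 'a) \<Rightarrow> 'b set \<Rightarrow> ('b \<Rightarrow> 'b \<Rightarrow> 'b) \<Rightarrow> bool" where
  "quandle_isomorphic X m Z n \<longleftrightarrow> (\<exists>g. quandle_hom X m Z n g \<and> bij_betw g X Z)"

definition ker_rel :: "'a set \<Rightarrow> ('a \<Rightarrow> 'b) \<Rightarrow> ('a \<times> 'a) set" where
  "ker_rel X f = {(x1, x2). x1 \<in> X \<and> x2 \<in> X \<and> f x1 = f x2}"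

definition ker_class :: "'a set \<Rightarrow> ('a \<Rightarrow> 'b) \<Rightarrow> 'a \<Rightarrow> 'a set" where
  "ker_class X f x = {x' \<in> X. f x' = f x}"

(* The union ranges over all choices of representatives. It is a single class,
   namely that of m x1 x2, exactly when the class of the product does not depend
   on these choices. *)
definition quot_op ::
  "'a set \<Rightarrow> ('a \<Rightarrow> 'a \<Rightarrow> 'a) \<Rightarrow> ('a \<Rightarrow> 'b) \<Rightarrow> 'a set \<Rightarrow> 'a set \<Rightarrow> 'a set" where
  "quot_op X m f A B = (\<Union>x1\<in>A. \<Union>x2\<in>B. ker_class X f (m x1 x2))"

lemma equiv_ker_rel: "equiv X (ker_rel X f)"
  by (rule equivI) (auto simp: ker_rel_def refl_on_def sym_def trans_def)

lemma ker_rel_Image: "x \<in> X \<Longrightarrow> ker_rel X f `` {x} = ker_class X f x"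
  by (auto simp: ker_rel_def ker_class_def)

end

theory Submission
  imports Defs
begin

text \<open>The classes are the fibres of \<open>f\<close>, so each is labelled by one value in
  \<open>Z\<close>. As \<open>f\<close> is a homomorphism, the value at a product depends only on
  the values at the factors, so the product of classes is independent of representatives
  (\<open>quot_op_ker_class\<close>). Closure, R2 and Q1 are then checked on representatives; R1
  also needs cancellation in \<open>Z\<close>.\<close>

lemma quotient_ker_rel: "X // ker_rel X f = ker_class X f ` X"
  by (auto simp: quotient_def ker_rel_Image)

lemma ker_class_self: "x \<in> X \<Longrightarrow> x \<in> ker_class X f x"
  by (simp add: ker_class_def)

lemma ker_class_eq_iff:
  "x \<in> X \<Longrightarrow> ker_class X f x = ker_class X f y \<longleftrightarrow> f x = f y"
  by (auto simp: ker_class_def)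

lemma the_elem_image_ker_class:
  assumes "x \<in> X"
  shows "the_elem (f ` ker_class X f x) = f x"
proof -
  have "f ` ker_class X f x = {f x}"
    using assms by (auto simp: ker_class_def)
  then show ?thesis by simp
qed

text \<open>Both elements solve the same R1 equation, whose solution is unique.\<close>

lemma (in quandle) right_cancel:
  "\<lbrakk>x \<in> X; y \<in> X; z \<in> X; m x z = m y z\<rbrakk> \<Longrightarrow> x = y"
  using R1[of "m x z" z] closed by blast

context quandle_hom
begin

lemma quot_op_ker_class:
  assumes "x \<in> X" "y \<in> X"
  shows "quot_op X m f (ker_class X f x) (ker_class X f y) = ker_class X f (m x y)"
proof -
  have "ker_class X f (m x' y') = ker_class X f (m x y)"
    if "x' \<in> ker_class X f x" "y' \<in> ker_class X f y" for x' y'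
    using that assms by (simp add: ker_class_def hom)
  \<comment> \<open>All sets in the union coincide; \<open>x\<close> and \<open>y\<close> themselves
    witness that the union is not over an empty family.\<close>
  then show ?thesis
    using ker_class_self[OF assms(1), of f] ker_class_self[OF assms(2), of f]
    unfolding quot_op_def by blast
qed

text \<open>Existence of left divisors passes from \<open>X\<close> to the quotient; their uniqueness
  does not, and is instead inherited from \<open>Z\<close>.\<close>
lemma quandle_quotient: "quandle (X // ker_rel X f) (quot_op X m f)"
  unfolding quotient_ker_rel
proof
  show "ker_class X f ` X \<noteq> {}"
    using dom.nonempty by simp
next
  fix A B assume "A \<in> ker_class X f ` X" "B \<in> ker_class X f ` X"
  then show "quot_op X m f A B \<in> ker_class X f ` X"
    by (auto simp: quot_op_ker_class dom.closed)
next
  fix A B assume "A \<in> ker_class X f ` X" "B \<in> ker_class X f ` X"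
  then obtain x y where x: "x \<in> X" "A = ker_class X f x"
    and y: "y \<in> X" "B = ker_class X f y"
    by blast
  obtain z where z: "z \<in> X" "x = m z y"
    using dom.R1 x(1) y(1) by blast
  show "\<exists>!C. C \<in> ker_class X f ` X \<and> A = quot_op X m f C B"
  proof (rule ex1I[of _ "ker_class X f z"])
    show "ker_class X f z \<in> ker_class X f ` X
        \<and> A = quot_op X m f (ker_class X f z) B"
      using x y z by (simp add: quot_op_ker_class)
  next
    fix C assume C: "C \<in> ker_class X f ` X \<and> A = quot_op X m f C B"
    then obtain w where w: "w \<in> X" "C = ker_class X f w"
      by blast
    have "ker_class X f x = ker_class X f (m w y)"
      using C w x y by (simp add: quot_op_ker_class)
    \<comment> \<open>Equal classes mean equal values of \<open>f\<close>, which moves the equation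
      into \<open>Z\<close>, where \<open>f y\<close> can be cancelled.\<close>
    then have "n (f z) (f y) = n (f w) (f y)"
      using x y z w by (simp add: ker_class_eq_iff hom)
    then have "f z = f w"
      using cod.right_cancel maps_to w(1) y(1) z(1) by blast
    then show "C = ker_class X f z"
      using w by (simp add: ker_class_eq_iff)
  qed
next
  fix A B C
  assume "A \<in> ker_class X f ` X" "B \<in> ker_class X f ` X" "C \<in> ker_class X f ` X"
  then show "quot_op X m f (quot_op X m f A B) C
      = quot_op X m f (quot_op X m f A C) (quot_op X m f B C)"
    by (auto simp: quot_op_ker_class dom.closed dom.R2[symmetric])
next
  fix A assume "A \<in> ker_class X f ` X"
  then show "quot_op X m f A A = A"
    by (auto simp: quot_op_ker_class dom.Q1)
qed

lemma quandle_hom_the_elem_image: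
  "quandle_hom (X // ker_rel X f) (quot_op X m f) Z n (\<lambda>A. the_elem (f ` A))"
proof (intro quandle_hom.intro quandle_hom_axioms.intro)
  show "quandle (X // ker_rel X f) (quot_op X m f)"
    by (rule quandle_quotient)
  show "quandle Z n" ..
qed (auto simp: quotient_ker_rel quot_op_ker_class the_elem_image_ker_class
      maps_to hom dom.closed)

text \<open>The first isomorphism theorem at the level of sets: a fibre is determined by its
  value.\<close>

lemma bij_betw_the_elem_image:
  "bij_betw (\<lambda>A. the_elem (f ` A)) (X // ker_rel X f) (f ` X)"
  unfolding bij_betw_def quotient_ker_rel
  by (auto simp: inj_on_def image_image the_elem_image_ker_class ker_class_eq_iff)

end

theorem theorem4p9:
  fixes X :: "'a set" and m :: "'a \<Rightarrow> 'a \<Rightarrow> 'a"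
    and Z :: "'b set" and n :: "'b \<Rightarrow> 'b \<Rightarrow> 'b"
    and f :: "'a \<Rightarrow> 'b"
  assumes "quandle_hom X m Z n f"
  shows "(\<forall>x1\<in>X. \<forall>x2\<in>X.
            quot_op X m f (ker_class X f x1) (ker_class X f x2) = ker_class X f (m x1 x2))
       \<and> quandle (X // ker_rel X f) (quot_op X m f)
       \<and> (f ` X = Z \<longrightarrow> quandle_isomorphic (X // ker_rel X f) (quot_op X m f) Z n)"
proof -
  interpret quandle_hom X m Z n f by fact
  show ?thesis
    unfolding quandle_isomorphic_def
    using quot_op_ker_class quandle_quotient quandle_hom_the_elem_image
      bij_betw_the_elem_image by blast
qed

end
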